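(* In the setting described in the context, assume that $f:I\times\mathbb{R}\to\mathbb{R}$ satisfies the stated Carath\'eodory condition, that there exists $K\in L^1(I)$, $K\ge0$, with $$|f(t,x)-f(t,y)|\le K(t)\,|x-y|\quad\text{for all }x,y\in\mathbb{R},\ t\in I,$$ and that $$P:=\max_{t\in I}\int_0^1|G(t,s,\delta_1,\dots,\delta_n)|\,K(s)\,ds<1.$$ Then the problem $$L_nu(t)=f(t,u(t))\ \text{ a.e. }t\in I,\qquad B_i(u)=\delta_iC_i(u),\ i=1,\dots,n,$$ has at least one solution $u\in C(I)$.
   Context: $I=[0,1]$, $n\ge1$. $L_nu(t)=u^{(n)}(t)+a_1(t)u^{(n-1)}(t)+\cdots+a_n(t)u(t)$ with $a_1,\dots,a_n\in L^1(I)$; solutions are understood to be in $C^{n-1}(I)$ with $u^{(n-1)}$ absolutely continuous. $B_i(u)=\sum_{j=0}^{n-1}\big(\alpha_j^iu^{(j)}(0)+\beta_j^iu^{(j)}(1)\big)$, $i=1,\dots,n$, with real constants $\alpha_j^i,\beta_j^i$; $C_1,\dots,C_n:C^{n-1}(I)\to\mathbb{R}$ are linear and continuous; $\delta_1,\dots,\delta_n\in\mathbb{R}$. It is assumed that the problem $L_nu=0$ a.e., $B_i(u)=0$ ($i=1,\dots,n$) has only the trivial solution. Then $g$ denotes its Green's function: for each $\sigma\in L^1(I)$ the unique solution of $L_nu=\sigma$ a.e., $B_i(u)=0$ ($i=1,\dots,n$) is $u(t)=\int_0^1g(t,s)\sigma(s)\,ds$. For $i=1,\dots,n$, $\omega_i$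 is the unique solution of $L_nu=0$ a.e., $B_i(u)=1$, $B_k(u)=0$ for $k\ne i$. It is also assumed that $\det(\mathrm{Id}-A)\ne0$, where $A=(a_{ij})_{n\times n}$, $a_{ij}=\delta_jC_i(\omega_j)$, and $(b_{ij})_{n\times n}=(\mathrm{Id}-A)^{-1}$. The notation $C_j(g(\cdot,s))$ stands for the (a.e. unique) bounded measurable function of $s$ such that $C_j\big(\int_0^1g(\cdot,s)\sigma(s)\,ds\big)=\int_0^1C_j(g(\cdot,s))\,\sigma(s)\,ds$ for all $\sigma\in L^1(I)$. Under these assumptions, for each $\sigma\in L^1(I)$ the linear problem $L_nu=\sigma$ a.e., $B_i(u)=\delta_iC_i(u)$ ($i=1,\dots,n$) has the unique solution $u(t)=\int_0^1G(t,s,\delta_1,\dots,\delta_n)\sigma(s)\,ds$, where $G$ is its Green's function, $$G(t,s,\delta_1,\dots,\delta_n)=g(t,s)+\sum_{i=1}^n\sum_{j=1}^n\delta_i\,b_{ij}\,\omega_i(t)\,C_j(g(\cdot,s)).$$ Carath\'eodory condition on $f$: $f(\cdot,x)$ is measurable for all $x\in\mathbb{R}$; $f(t,\cdot)$ is continuous for a.e. $t\in I$; and for every $R>0$ there is $\phi_R$, with $\phi_R\in L^1(I)$ if $n\ge2$ and $\phi_R\in L^\infty(I)$ if $n=1$, such that $|f(t,x)|\le\phi_R(t)$ for all $x\in[-R,R]$ and a.e. $t\in I$. *)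

theory Defs
  imports "HOL-Analysis.Analysis"
begin

text \<open>Functions on the unit interval are total functions on the reals of which only the
  values on \<open>{0..1}\<close> matter.  The space of integrable functions on the unit interval is
  \<^term>\<open>integrable (lebesgue_on {0..1})\<close>.\<close>

text \<open>Derivatives are taken within \<open>{0..1}\<close>, hence are one-sided at the end points and
  depend only on the restriction of the function to \<open>{0..1}\<close>.\<close>

primrec nderiv :: "nat \<Rightarrow> (real \<Rightarrow> real) \<Rightarrow> real \<Rightarrow> real" where
  "nderiv 0 u = u"
| "nderiv (Suc k) u = (\<lambda>t. vector_derivative (nderiv k u) (at t within {0..1}))"

definition Ck_space :: "nat \<Rightarrow> (real \<Rightarrow> real) set" where
  "Ck_space m = {u. (\<forall>k<m. nderiv k u differentiable_on {0..1}) \<and>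
                    continuous_on {0..1} (nderiv m u)}"

definition Ck_norm :: "nat \<Rightarrow> (real \<Rightarrow> real) \<Rightarrow> real" where
  "Ck_norm m u = (\<Sum>k\<le>m. SUP t\<in>{0..1}. \<bar>nderiv k u t\<bar>)"

text \<open>Two members of \<^term>\<open>Ck_space m\<close> that agree on \<open>{0..1}\<close> are at distance 0, so
  continuity forces a functional to depend only on the restriction to \<open>{0..1}\<close>.\<close>

definition continuous_linear_functional :: "nat \<Rightarrow> ((real \<Rightarrow> real) \<Rightarrow> real) \<Rightarrow> bool" where
  "continuous_linear_functional m C \<longleftrightarrow>
     (\<forall>u\<in>Ck_space m. \<forall>v\<in>Ck_space m. C (\<lambda>t. u t + v t) = C u + C v) \<and>
     (\<forall>c. \<forall>u\<in>Ck_space m. C (\<lambda>t. c * u t) = c * C u) \<and>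
     (\<forall>u\<in>Ck_space m. \<forall>\<epsilon>>0. \<exists>\<delta>>0. \<forall>v\<in>Ck_space m.
        Ck_norm m (\<lambda>t. v t - u t) < \<delta> \<longrightarrow> \<bar>C v - C u\<bar> < \<epsilon>)"

text \<open>Absolute continuity on \<open>{0..1}\<close>, over finite families \<open>(l i, r i)\<close>, \<open>i < m\<close>, of
  non-overlapping subintervals.\<close>

definition abs_continuous :: "(real \<Rightarrow> real) \<Rightarrow> bool" where
  "abs_continuous v \<longleftrightarrow>
     (\<forall>\<epsilon>>0. \<exists>\<delta>>0. \<forall>(m::nat) l r.
        (\<forall>i<m. 0 \<le> l i \<and> l i \<le> r i \<and> r i \<le> 1) \<and>
        (\<forall>i<m. \<forall>j<m. i \<noteq> j \<longrightarrow> {l i<..<r i} \<inter> {l j<..<r j} = {}) \<and>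
        (\<Sum>i<m. r i - l i) < \<delta>
        \<longrightarrow> (\<Sum>i<m. \<bar>v (r i) - v (l i)\<bar>) < \<epsilon>)"

definition Lop :: "nat \<Rightarrow> (nat \<Rightarrow> real \<Rightarrow> real) \<Rightarrow> (real \<Rightarrow> real) \<Rightarrow> real \<Rightarrow> real" where
  "Lop n a u t = nderiv n u t + (\<Sum>i = 1..n. a i t * nderiv (n - i) u t)"

text \<open>An absolutely continuous function is differentiable almost everywhere; this is spelled
  out below so that \<open>Lop n a u t\<close> involves a genuine derivative of order \<open>n\<close> and not a junk
  value of \<^const>\<open>vector_derivative\<close>.\<close>

definition ode_solution ::
  "nat \<Rightarrow> (nat \<Rightarrow> real \<Rightarrow> real) \<Rightarrow> (real \<Rightarrow> real) \<Rightarrow> (real \<Rightarrow> real) \<Rightarrow> bool" where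
  "ode_solution n a \<sigma> u \<longleftrightarrow>
     u \<in> Ck_space (n - 1) \<and> abs_continuous (nderiv (n - 1) u) \<and>
     (AE t in lebesgue_on {0..1}.
        nderiv (n - 1) u differentiable (at t within {0..1}) \<and> Lop n a u t = \<sigma> t)"

definition bdry_form ::
  "nat \<Rightarrow> ('n \<Rightarrow> nat \<Rightarrow> real) \<Rightarrow> ('n \<Rightarrow> nat \<Rightarrow> real) \<Rightarrow> 'n \<Rightarrow> (real \<Rightarrow> real) \<Rightarrow> real" where
  "bdry_form n \<alpha> \<beta> i u = (\<Sum>j<n. \<alpha> i j * nderiv j u 0 + \<beta> i j * nderiv j u 1)"

text \<open>\<open>u\<close> is, up to its values outside \<open>{0..1}\<close>, the only solution of \<open>L u = \<sigma>\<close> a.e.\ with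
  boundary values \<open>B i u = h i\<close>.\<close>

definition unique_bvp_solution ::
  "nat \<Rightarrow> (nat \<Rightarrow> real \<Rightarrow> real) \<Rightarrow> ('n \<Rightarrow> nat \<Rightarrow> real) \<Rightarrow> ('n \<Rightarrow> nat \<Rightarrow> real) \<Rightarrow>
   (real \<Rightarrow> real) \<Rightarrow> ('n \<Rightarrow> real) \<Rightarrow> (real \<Rightarrow> real) \<Rightarrow> bool" where
  "unique_bvp_solution n a \<alpha> \<beta> \<sigma> h u \<longleftrightarrow>
     ode_solution n a \<sigma> u \<and> (\<forall>i. bdry_form n \<alpha> \<beta> i u = h i) \<and>
     (\<forall>v. ode_solution n a \<sigma> v \<and> (\<forall>i. bdry_form n \<alpha> \<beta> i v = h i) \<longrightarrow> (\<forall>t\<in>{0..1}. v t = u t))"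

text \<open>Integrability of the integrand is required explicitly, since the Bochner integral of a
  non-integrable function is 0 by convention.\<close>

definition greens_function ::
  "nat \<Rightarrow> (nat \<Rightarrow> real \<Rightarrow> real) \<Rightarrow> ('n \<Rightarrow> nat \<Rightarrow> real) \<Rightarrow> ('n \<Rightarrow> nat \<Rightarrow> real) \<Rightarrow>
   (real \<Rightarrow> real \<Rightarrow> real) \<Rightarrow> bool" where
  "greens_function n a \<alpha> \<beta> g \<longleftrightarrow>
     (\<forall>\<sigma>. integrable (lebesgue_on {0..1}) \<sigma> \<longrightarrow>
        (\<forall>t\<in>{0..1}. integrable (lebesgue_on {0..1}) (\<lambda>s. g t s * \<sigma> s)) \<and>
        unique_bvp_solution n a \<alpha> \<beta> \<sigma> (\<lambda>i. 0) (\<lambda>t. LINT s|lebesgue_on {0..1}. g t s * \<sigma> s))"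

text \<open>The function of \<open>s\<close> denoted by \<open>C(g(\<cdot>,s))\<close>.  It is defined by duality, not by applying
  \<open>C\<close> to \<open>g(\<cdot>,s)\<close>, because the latter need not belong to \<^term>\<open>Ck_space (n - 1)\<close>.\<close>

definition functional_of_kernel ::
  "((real \<Rightarrow> real) \<Rightarrow> real) \<Rightarrow> (real \<Rightarrow> real \<Rightarrow> real) \<Rightarrow> (real \<Rightarrow> real) \<Rightarrow> bool" where
  "functional_of_kernel C g c \<longleftrightarrow>
     c \<in> borel_measurable (lebesgue_on {0..1}) \<and> bounded (c ` {0..1}) \<and>
     (\<forall>\<sigma>. integrable (lebesgue_on {0..1}) \<sigma> \<longrightarrow>
        C (\<lambda>t. LINT s|lebesgue_on {0..1}. g t s * \<sigma> s) = (LINT s|lebesgue_on {0..1}. c s * \<sigma> s))"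

definition coupling_matrix ::
  "('n \<Rightarrow> (real \<Rightarrow> real) \<Rightarrow> real) \<Rightarrow> ('n \<Rightarrow> real) \<Rightarrow> ('n \<Rightarrow> real \<Rightarrow> real) \<Rightarrow> real^'n^'n" where
  "coupling_matrix C \<delta> \<omega> = (\<chi> i j. \<delta> j * C i (\<omega> j))"

text \<open>The Green's function of the problem \<open>L u = \<sigma>\<close>, \<open>B i u = \<delta> i * C i u\<close>, given the matrix
  \<open>b\<close> and the functions \<open>Cg j s\<close> standing for \<open>C j (g(\<cdot>,s))\<close>.\<close>

definition nonlocal_green ::
  "(real \<Rightarrow> real \<Rightarrow> real) \<Rightarrow> ('n::finite \<Rightarrow> real) \<Rightarrow> real^'n^'n \<Rightarrow> ('n \<Rightarrow> real \<Rightarrow> real) \<Rightarrow>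
   ('n \<Rightarrow> real \<Rightarrow> real) \<Rightarrow> real \<Rightarrow> real \<Rightarrow> real" where
  "nonlocal_green g \<delta> b \<omega> Cg t s =
     g t s + (\<Sum>i\<in>UNIV. \<Sum>j\<in>UNIV. \<delta> i * b $ i $ j * \<omega> i t * Cg j s)"

definition caratheodory :: "nat \<Rightarrow> (real \<Rightarrow> real \<Rightarrow> real) \<Rightarrow> bool" where
  "caratheodory n f \<longleftrightarrow>
     (\<forall>x. (\<lambda>t. f t x) \<in> borel_measurable (lebesgue_on {0..1})) \<and>
     (AE t in lebesgue_on {0..1}. continuous_on UNIV (f t)) \<and>
     (\<forall>R>0. \<exists>\<phi>.
        (if n = 1 then \<phi> \<in> borel_measurable (lebesgue_on {0..1}) \<and>
                       (\<exists>M. AE t in lebesgue_on {0..1}. \<bar>\<phi> t\<bar> \<le> M)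
         else integrable (lebesgue_on {0..1}) \<phi>) \<and>
        (AE t in lebesgue_on {0..1}. \<forall>x\<in>{-R..R}. \<bar>f t x\<bar> \<le> \<phi> t))"

end

theory Submission
  imports Defs
begin

text \<open>
  The Green's function turns the boundary value problem into the fixed point equation
  \<open>u = T u\<close> with \<open>T u t = \<integral> G t s * f s (u s) ds\<close> on the continuous functions on \<open>{0..1}\<close>.
  The Lipschitz condition gives
  \<open>\<bar>T u t - T v t\<bar> \<le> (\<integral> \<bar>G t s\<bar> * K s ds) * sup \<bar>u - v\<bar> \<le> P * sup \<bar>u - v\<bar>\<close>, so that
  \<open>T\<close> is a contraction of a complete metric space, and Banach's principle
  (\<open>contraction_fixed_point_on_unit_interval\<close>) yields a fixed point.  The integrals make
  sense because \<open>s \<mapsto> f s (u s)\<close> is integrable: it is measurable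
  (\<open>borel_measurable_superposition\<close>) and bounded by \<open>\<bar>f s 0\<bar> + K s * sup \<bar>u\<bar>\<close>.

  Why \<open>G\<close> is the right kernel is the content of \<open>nonlocal_problem_solution\<close>.  Let \<open>w\<close>
  be the solution of \<open>L w = \<sigma>\<close> with homogeneous local conditions.  By superposition,
  \<open>w + (\<Sum>i. c i * \<omega> i)\<close> still solves the equation, and its \<open>k\<close>-th boundary form is \<open>c k\<close>.
  With \<open>c i = \<delta> i * d i\<close>, the nonlocal conditions hold as soon as
  \<open>d k = C k w + (\<Sum>i. \<delta> i * C k (\<omega> i) * d i)\<close>, that is \<open>(Id - A) d = (C k w)\<^sub>k\<close>, and
  \<open>d\<close> is obtained by applying \<open>b = (Id - A)\<^sup>-\<^sup>1\<close>.  As \<open>C j w\<close> is the integral of \<open>\<sigma>\<close> against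
  \<open>C j (g(\<cdot>,s))\<close>, the function so obtained is the integral of \<open>\<sigma>\<close> against \<open>G\<close>.
\<close>

section \<open>Superposition of solutions\<close>

lemma vector_derivative_lincomb:
  fixes p q h :: "real \<Rightarrow> real"
  assumes "p differentiable (at t within {0..1})" "q differentiable (at t within {0..1})"
    and t: "t \<in> {0..1}" and h: "\<And>s. s \<in> {0..1} \<Longrightarrow> h s = p s + c * q s"
  shows "h differentiable (at t within {0..1})"
    and "vector_derivative h (at t within {0..1}) =
         vector_derivative p (at t within {0..1}) + c * vector_derivative q (at t within {0..1})"
proof -
  let ?D = "\<lambda>r. vector_derivative r (at t within {0..1})"
  have "(p has_vector_derivative ?D p) (at t within {0..1})"
    "(q has_vector_derivative ?D q) (at t within {0..1})"
    using assms(1,2) by (simp_all add: vector_derivative_works)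
  then have "((\<lambda>s. p s + c * q s) has_vector_derivative ?D p + c * ?D q) (at t within {0..1})"
    by (intro has_vector_derivative_add has_vector_derivative_mult_right)
  then have D: "(h has_vector_derivative ?D p + c * ?D q) (at t within {0..1})"
    by (rule has_vector_derivative_transform[OF t h, rotated])
  then show "h differentiable (at t within {0..1})"
    by (rule differentiableI_vector)
  show "?D h = ?D p + c * ?D q"
    using vector_derivative_within_closed_interval[OF _ t D] by simp
qed

lemma nderiv_lincomb:
  assumes "u \<in> Ck_space m" "v \<in> Ck_space m" "k \<le> m" "t \<in> {0..1}"
  shows "nderiv k (\<lambda>t. u t + c * v t) t = nderiv k u t + c * nderiv k v t"
  using assms(3,4)
proof (induction k arbitrary: t)
  case (Suc k)
  have "nderiv k u differentiable (at t within {0..1})"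
    "nderiv k v differentiable (at t within {0..1})"
    using assms(1,2) Suc.prems by (auto simp: Ck_space_def differentiable_on_def)
  then show ?case
    using vector_derivative_lincomb(2)[of "nderiv k u" t "nderiv k v"
        "nderiv k (\<lambda>t. u t + c * v t)" c] Suc by simp
qed simp

lemma Ck_space_lincomb:
  assumes u: "u \<in> Ck_space m" and v: "v \<in> Ck_space m"
  shows "(\<lambda>t. u t + c * v t) \<in> Ck_space m"
proof -
  have eq: "nderiv k (\<lambda>t. u t + c * v t) t = nderiv k u t + c * nderiv k v t"
    if "k \<le> m" "t \<in> {0..1}" for k t
    using nderiv_lincomb[OF u v that] .
  have "nderiv k (\<lambda>t. u t + c * v t) differentiable (at t within {0..1})"
    if "k < m" "t \<in> {0..1}" for k t
  proof (rule vector_derivative_lincomb(1))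
    show "nderiv k u differentiable (at t within {0..1})"
      "nderiv k v differentiable (at t within {0..1})"
      using u v that by (auto simp: Ck_space_def differentiable_on_def)
  qed (use that eq in auto)
  moreover have "continuous_on {0..1} (nderiv m (\<lambda>t. u t + c * v t))"
  proof (subst continuous_on_cong[OF refl])
    show "nderiv m (\<lambda>t. u t + c * v t) t = nderiv m u t + c * nderiv m v t"
      if "t \<in> {0..1}" for t
      using eq that by simp
    show "continuous_on {0..1} (\<lambda>t. nderiv m u t + c * nderiv m v t)"
      using u v by (intro continuous_intros) (auto simp: Ck_space_def)
  qed
  ultimately show ?thesis
    by (auto simp: Ck_space_def differentiable_on_def)
qed

lemma Ck_space_imp_continuous:
  assumes "u \<in> Ck_space m"
  shows "continuous_on {0..1} u"
proof (cases m)
  case 0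
  then show ?thesis using assms by (simp add: Ck_space_def)
next
  case (Suc k)
  then have "nderiv 0 u differentiable_on {0..1}"
    using assms unfolding Ck_space_def by blast
  then show ?thesis by (simp add: differentiable_imp_continuous_on)
qed

lemma Ck_space_sum:
  assumes "finite A" "u \<in> Ck_space m" "\<And>i. i \<in> A \<Longrightarrow> v i \<in> Ck_space m"
  shows "(\<lambda>t. u t + (\<Sum>i\<in>A. c i * v i t)) \<in> Ck_space m"
  using assms(1,3)
proof (induction A)
  case (insert i A)
  then have "(\<lambda>t. (u t + (\<Sum>i\<in>A. c i * v i t)) + c i * v i t) \<in> Ck_space m"
    by (intro Ck_space_lincomb) auto
  then show ?case using insert.hyps by (simp add: add_ac)
qed (use assms(2) in simp)

text \<open>Common to the boundary forms and to the functionals \<open>C i\<close>.\<close>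

lemma linear_on_Ck_space_sum:
  fixes \<Phi> :: "(real \<Rightarrow> real) \<Rightarrow> real"
  assumes lin: "\<And>u v c. u \<in> Ck_space m \<Longrightarrow> v \<in> Ck_space m \<Longrightarrow>
      \<Phi> (\<lambda>t. u t + c * v t) = \<Phi> u + c * \<Phi> v"
    and "finite A" and u: "u \<in> Ck_space m" and "\<And>i. i \<in> A \<Longrightarrow> v i \<in> Ck_space m"
  shows "\<Phi> (\<lambda>t. u t + (\<Sum>i\<in>A. c i * v i t)) = \<Phi> u + (\<Sum>i\<in>A. c i * \<Phi> (v i))"
  using assms(2,4)
proof (induction A)
  case (insert i A)
  have "(\<lambda>t. u t + (\<Sum>i\<in>A. c i * v i t)) \<in> Ck_space m"
    using insert.hyps insert.prems u by (intro Ck_space_sum) auto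
  then have "\<Phi> (\<lambda>t. (u t + (\<Sum>i\<in>A. c i * v i t)) + c i * v i t) =
      \<Phi> (\<lambda>t. u t + (\<Sum>i\<in>A. c i * v i t)) + c i * \<Phi> (v i)"
    using insert.prems by (intro lin) auto
  moreover have "\<Phi> (\<lambda>t. u t + (\<Sum>i\<in>A. c i * v i t)) = \<Phi> u + (\<Sum>i\<in>A. c i * \<Phi> (v i))"
    using insert.IH insert.prems by blast
  ultimately show ?case using insert.hyps by (simp add: add_ac)
qed simp

lemma continuous_linear_functional_lincomb:
  assumes C: "continuous_linear_functional m C" and u: "u \<in> Ck_space m" and v: "v \<in> Ck_space m"
  shows "C (\<lambda>t. u t + c * v t) = C u + c * C v"
proof -
  \<comment> \<open>A multiple of \<open>v\<close> is a combination of \<open>v - v\<close> and \<open>v\<close>.\<close>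
  have "(\<lambda>t. (v t + (-1) * v t) + c * v t) \<in> Ck_space m"
    using v by (intro Ck_space_lincomb)
  then have "(\<lambda>t. c * v t) \<in> Ck_space m" by simp
  then show ?thesis
    using C u v by (simp add: continuous_linear_functional_def)
qed

lemma bdry_form_lincomb:
  assumes "u \<in> Ck_space (n - 1)" "v \<in> Ck_space (n - 1)"
  shows "bdry_form n \<alpha> \<beta> i (\<lambda>t. u t + c * v t) = bdry_form n \<alpha> \<beta> i u + c * bdry_form n \<alpha> \<beta> i v"
proof -
  have "nderiv j (\<lambda>t. u t + c * v t) t = nderiv j u t + c * nderiv j v t"
    if "j < n" "t \<in> {0..1}" for j t
    using assms that by (intro nderiv_lincomb) auto
  then show ?thesis
    by (simp add: bdry_form_def algebra_simps sum.distrib sum_distrib_left)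
qed

lemma AE_lebesgue_on_unit_interval: "AE t in lebesgue_on {0..1}. t \<in> {0..1::real}"
  using AE_space[of "lebesgue_on {0..1::real}"] by (simp only: space_lebesgue_on)

lemma abs_continuous_lincomb:
  assumes p: "abs_continuous p" and q: "abs_continuous q"
    and h: "\<And>t. t \<in> {0..1} \<Longrightarrow> h t = p t + c * q t"
  shows "abs_continuous h"
  unfolding abs_continuous_def
proof (intro allI impI)
  fix \<epsilon> :: real assume \<epsilon>: "\<epsilon> > 0"
  define \<eta> where "\<eta> = \<epsilon> / (2 * (\<bar>c\<bar> + 1))"
  have \<eta>: "\<eta> > 0" "\<bar>c\<bar> * \<eta> \<le> \<epsilon> / 2"
    using \<epsilon> by (auto simp: \<eta>_def field_simps)
  define small where "small \<equiv> \<lambda>\<delta> (m::nat) l r.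
        (\<forall>i<m. 0 \<le> l i \<and> l i \<le> r i \<and> r i \<le> (1::real)) \<and>
        (\<forall>i<m. \<forall>j<m. i \<noteq> j \<longrightarrow> {l i<..<r i} \<inter> {l j<..<r j} = {}) \<and>
        (\<Sum>i<m. r i - l i) < (\<delta>::real)"
  have ac: "abs_continuous v \<longleftrightarrow>
      (\<forall>\<epsilon>>0. \<exists>\<delta>>0. \<forall>m l r. small \<delta> m l r \<longrightarrow> (\<Sum>i<m. \<bar>v (r i) - v (l i)\<bar>) < \<epsilon>)" for v
    unfolding abs_continuous_def small_def by (rule refl)
  obtain \<delta>1 where \<delta>1: "\<delta>1 > 0"
    "\<And>m l r. small \<delta>1 m l r \<Longrightarrow> (\<Sum>i<m. \<bar>p (r i) - p (l i)\<bar>) < \<epsilon> / 2"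
    using p[unfolded ac, rule_format, OF half_gt_zero[OF \<epsilon>]] by blast
  obtain \<delta>2 where \<delta>2: "\<delta>2 > 0"
    "\<And>m l r. small \<delta>2 m l r \<Longrightarrow> (\<Sum>i<m. \<bar>q (r i) - q (l i)\<bar>) < \<eta>"
    using q[unfolded ac, rule_format, OF \<eta>(1)] by blast
  have "(\<Sum>i<m. \<bar>h (r i) - h (l i)\<bar>) < \<epsilon>" if s: "small (min \<delta>1 \<delta>2) m l r" for m l r
  proof -
    have "(\<Sum>i<m. \<bar>h (r i) - h (l i)\<bar>) \<le>
        (\<Sum>i<m. \<bar>p (r i) - p (l i)\<bar> + \<bar>c\<bar> * \<bar>q (r i) - q (l i)\<bar>)"
    proof (rule sum_mono)
      fix i assume "i \<in> {..<m}"
      then have i: "0 \<le> l i" "l i \<le> r i" "r i \<le> 1"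
        using s by (auto simp: small_def)
      then have "h (r i) - h (l i) = (p (r i) - p (l i)) + c * (q (r i) - q (l i))"
        by (simp add: h algebra_simps)
      then show "\<bar>h (r i) - h (l i)\<bar> \<le> \<bar>p (r i) - p (l i)\<bar> + \<bar>c\<bar> * \<bar>q (r i) - q (l i)\<bar>"
        by (metis abs_triangle_ineq abs_mult)
    qed
    also have "\<dots> = (\<Sum>i<m. \<bar>p (r i) - p (l i)\<bar>) + \<bar>c\<bar> * (\<Sum>i<m. \<bar>q (r i) - q (l i)\<bar>)"
      by (simp add: sum.distrib sum_distrib_left)
    also have "\<dots> < \<epsilon> / 2 + \<bar>c\<bar> * \<eta>"
      using s \<delta>1(2)[of m l r] \<delta>2(2)[of m l r]
      by (intro add_less_le_mono mult_left_mono) (auto simp: small_def)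
    finally show ?thesis using \<eta>(2) by simp
  qed
  then show "\<exists>\<delta>>0. \<forall>(m::nat) l r.
        (\<forall>i<m. 0 \<le> l i \<and> l i \<le> r i \<and> r i \<le> 1) \<and>
        (\<forall>i<m. \<forall>j<m. i \<noteq> j \<longrightarrow> {l i<..<r i} \<inter> {l j<..<r j} = {}) \<and>
        (\<Sum>i<m. r i - l i) < \<delta>
        \<longrightarrow> (\<Sum>i<m. \<bar>h (r i) - h (l i)\<bar>) < \<epsilon>"
    using \<delta>1(1) \<delta>2(1) unfolding small_def by (intro exI[of _ "min \<delta>1 \<delta>2"]) auto
qed

text \<open>The derivative of order \<open>n\<close> exists only almost everywhere, so its linearity, unlike that
  of the lower ones, holds at the common points of differentiability.\<close>

lemma ode_solution_lincomb:
  assumes n: "n \<ge> 1" and u: "ode_solution n a \<sigma> u" and v: "ode_solution n a \<tau> v"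
  shows "ode_solution n a (\<lambda>t. \<sigma> t + c * \<tau> t) (\<lambda>t. u t + c * v t)"
proof -
  let ?h = "\<lambda>t. u t + c * v t"
  have uC: "u \<in> Ck_space (n - 1)" and vC: "v \<in> Ck_space (n - 1)"
    using u v by (auto simp: ode_solution_def)
  have low: "nderiv k ?h t = nderiv k u t + c * nderiv k v t" if "k < n" "t \<in> {0..1}" for k t
    using nderiv_lincomb[OF uC vC] that by simp
  have ac: "abs_continuous (nderiv (n - 1) ?h)"
  proof (rule abs_continuous_lincomb)
    show "abs_continuous (nderiv (n - 1) u)" "abs_continuous (nderiv (n - 1) v)"
      using u v by (simp_all add: ode_solution_def)
    show "nderiv (n - 1) ?h t = nderiv (n - 1) u t + c * nderiv (n - 1) v t" if "t \<in> {0..1}" for t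
      using low that n by simp
  qed
  have "AE t in lebesgue_on {0..1}.
      nderiv (n - 1) u differentiable (at t within {0..1}) \<and> Lop n a u t = \<sigma> t"
    "AE t in lebesgue_on {0..1}.
      nderiv (n - 1) v differentiable (at t within {0..1}) \<and> Lop n a v t = \<tau> t"
    using u v unfolding ode_solution_def by blast+
  with AE_lebesgue_on_unit_interval have "AE t in lebesgue_on {0..1}.
      nderiv (n - 1) ?h differentiable (at t within {0..1}) \<and> Lop n a ?h t = \<sigma> t + c * \<tau> t"
  proof eventually_elim
    case (elim t)
    note D = vector_derivative_lincomb[of "nderiv (n - 1) u" t "nderiv (n - 1) v" "nderiv (n - 1) ?h" c]
    obtain k where k: "n = Suc k" using n by (cases n) auto
    have top: "nderiv n ?h t = nderiv n u t + c * nderiv n v t"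
      using D(2) elim low by (simp add: k)
    have "nderiv (n - i) ?h t = nderiv (n - i) u t + c * nderiv (n - i) v t" if "i \<in> {1..n}" for i
      using low that elim by simp
    then have "Lop n a ?h t = Lop n a u t + c * Lop n a v t"
      by (simp add: Lop_def top algebra_simps sum.distrib sum_distrib_left)
    then show ?case using D(1) elim low n by simp
  qed
  then show ?thesis
    using ac Ck_space_lincomb[OF uC vC] by (simp add: ode_solution_def)
qed

lemma ode_solution_sum:
  assumes n: "n \<ge> 1" and "finite A" and u: "ode_solution n a \<sigma> u"
    and "\<And>i. i \<in> A \<Longrightarrow> ode_solution n a (\<lambda>t. 0) (v i)"
  shows "ode_solution n a \<sigma> (\<lambda>t. u t + (\<Sum>i\<in>A. c i * v i t))"
  using assms(2,4)
proof (induction A)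
  case (insert i A)
  then have "ode_solution n a (\<lambda>t. \<sigma> t + c i * 0) (\<lambda>t. (u t + (\<Sum>i\<in>A. c i * v i t)) + c i * v i t)"
    by (intro ode_solution_lincomb[OF n]) auto
  then show ?case using insert.hyps by (simp add: add_ac)
qed (use u in simp)

lemma ode_solution_cong:
  assumes "ode_solution n a \<sigma> u" "\<And>t. t \<in> {0..1} \<Longrightarrow> \<sigma> t = \<tau> t"
  shows "ode_solution n a \<tau> u"
proof -
  have "AE t in lebesgue_on {0..1}.
      nderiv (n - 1) u differentiable (at t within {0..1}) \<and> Lop n a u t = \<sigma> t"
    using assms(1) unfolding ode_solution_def by blast
  with AE_lebesgue_on_unit_interval have "AE t in lebesgue_on {0..1}.
      nderiv (n - 1) u differentiable (at t within {0..1}) \<and> Lop n a u t = \<tau> t"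
    by eventually_elim (simp add: assms(2))
  then show ?thesis
    using assms(1) by (simp add: ode_solution_def)
qed

section \<open>The linear nonlocal problem\<close>

lemma matrix_mult_matrix_inv:
  assumes "invertible A"
  shows "A ** matrix_inv A = mat 1"
  using someI_ex[OF assms[unfolded invertible_def]] by (simp add: matrix_inv_def)

lemma integrable_bounded_mult:
  fixes c \<sigma> :: "'a \<Rightarrow> real"
  assumes c: "c \<in> borel_measurable M" and bdd: "bounded (c ` space M)" and \<sigma>: "integrable M \<sigma>"
  shows "integrable M (\<lambda>s. c s * \<sigma> s)"
proof -
  obtain B where B: "\<And>s. s \<in> space M \<Longrightarrow> \<bar>c s\<bar> \<le> B"
    using bdd by (auto simp: bounded_iff)
  show ?thesis
  proof (rule Bochner_Integration.integrable_bound)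
    show "integrable M (\<lambda>s. B * \<sigma> s)" using \<sigma> by simp
    show "(\<lambda>s. c s * \<sigma> s) \<in> borel_measurable M"
      using c \<sigma> by (intro borel_measurable_times) auto
    show "AE s in M. norm (c s * \<sigma> s) \<le> norm (B * \<sigma> s)"
      using B by (intro AE_I2) (simp add: abs_mult mult_right_mono order_trans[OF _ abs_ge_self])
  qed
qed

lemma nonlocal_green_integral:
  fixes \<delta> :: "'n::finite \<Rightarrow> real"
  assumes g: "greens_function n a \<alpha> \<beta> g" and Cg: "\<And>j. functional_of_kernel (C j) g (Cg j)"
    and \<sigma>: "integrable (lebesgue_on {0..1}) \<sigma>" and t: "t \<in> {0..1}"
  defines "w \<equiv> \<lambda>t. LINT s|lebesgue_on {0..1}. g t s * \<sigma> s"
  shows "integrable (lebesgue_on {0..1}) (\<lambda>s. nonlocal_green g \<delta> b \<omega> Cg t s * \<sigma> s)" (is ?int)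
    and "(LINT s|lebesgue_on {0..1}. nonlocal_green g \<delta> b \<omega> Cg t s * \<sigma> s) =
      w t + (\<Sum>i\<in>UNIV. \<delta> i * (b *v (\<chi> j. C j w)) $ i * \<omega> i t)" (is ?eq)
proof -
  have gI: "integrable (lebesgue_on {0..1}) (\<lambda>s. g t s * \<sigma> s)"
    using g \<sigma> t by (auto simp: greens_function_def)
  have CgI: "integrable (lebesgue_on {0..1}) (\<lambda>s. Cg j s * \<sigma> s)" for j
    using Cg[of j] \<sigma> by (intro integrable_bounded_mult)
      (auto simp: functional_of_kernel_def space_restrict_space)
  have Cw: "C j w = (LINT s|lebesgue_on {0..1}. Cg j s * \<sigma> s)" for j
    using Cg[of j] \<sigma> by (simp add: functional_of_kernel_def w_def)
  have G: "nonlocal_green g \<delta> b \<omega> Cg t s * \<sigma> s =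
      g t s * \<sigma> s + (\<Sum>i\<in>UNIV. \<Sum>j\<in>UNIV. \<delta> i * b $ i $ j * \<omega> i t * (Cg j s * \<sigma> s))" for s
    by (simp add: nonlocal_green_def algebra_simps sum_distrib_left sum_distrib_right)
  show ?int
    unfolding G using gI CgI by (intro Bochner_Integration.integrable_add
      Bochner_Integration.integrable_sum integrable_mult_right)
  have "(LINT s|lebesgue_on {0..1}. nonlocal_green g \<delta> b \<omega> Cg t s * \<sigma> s) =
      w t + (\<Sum>i\<in>UNIV. \<Sum>j\<in>UNIV. \<delta> i * b $ i $ j * \<omega> i t *
      (LINT s|lebesgue_on {0..1}. Cg j s * \<sigma> s))"
    unfolding G using gI CgI by (simp add: w_def)
  also have "\<dots> = w t + (\<Sum>i\<in>UNIV. \<Sum>j\<in>UNIV. \<delta> i * b $ i $ j * \<omega> i t * C j w)"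
    by (simp only: Cw)
  also have "\<dots> = w t + (\<Sum>i\<in>UNIV. \<delta> i * (b *v (\<chi> j. C j w)) $ i * \<omega> i t)"
    by (simp add: matrix_vector_mult_def sum_distrib_left sum_distrib_right mult_ac)
  finally show ?eq .
qed

text \<open>The value \<open>d i\<close> that \<open>C i\<close> takes at the solution must satisfy \<open>(Id - A) d = (C i w)\<^sub>i\<close>.
  The boundary forms of the \<open>\<omega> i\<close> form the identity matrix, so the coefficients
  \<open>\<delta> i * d i\<close> are read off as boundary values.\<close>

lemma nonlocal_problem_solution:
  fixes C :: "'n::finite \<Rightarrow> (real \<Rightarrow> real) \<Rightarrow> real" and \<delta> :: "'n \<Rightarrow> real"
  assumes n: "n \<ge> 1"
    and C: "\<And>i. continuous_linear_functional (n - 1) (C i)"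
    and \<omega>: "\<And>i. unique_bvp_solution n a \<alpha> \<beta> (\<lambda>t. 0) (\<lambda>k. if k = i then 1 else 0) (\<omega> i)"
    and det: "det (mat 1 - coupling_matrix C \<delta> \<omega>) \<noteq> 0"
    and b: "b = matrix_inv (mat 1 - coupling_matrix C \<delta> \<omega>)"
    and w: "ode_solution n a \<sigma> w" "\<And>i. bdry_form n \<alpha> \<beta> i w = 0"
  defines "U \<equiv> \<lambda>t. w t + (\<Sum>i\<in>UNIV. \<delta> i * (b *v (\<chi> j. C j w)) $ i * \<omega> i t)"
  shows "ode_solution n a \<sigma> U" and "\<And>k. bdry_form n \<alpha> \<beta> k U = \<delta> k * C k U"
proof -
  define d where "d = b *v (\<chi> j. C j w)"
  have U: "U = (\<lambda>t. w t + (\<Sum>i\<in>UNIV. \<delta> i * d $ i * \<omega> i t))"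
    by (simp add: U_def d_def)
  have \<omega>_ode: "ode_solution n a (\<lambda>t. 0) (\<omega> i)" for i
    using \<omega> by (simp add: unique_bvp_solution_def)
  have \<omega>_bdry: "bdry_form n \<alpha> \<beta> k (\<omega> i) = (if k = i then 1 else 0)" for i k
    using \<omega> by (simp add: unique_bvp_solution_def)
  have wC: "w \<in> Ck_space (n - 1)" and \<omega>C: "\<omega> i \<in> Ck_space (n - 1)" for i
    using w \<omega>_ode by (auto simp: ode_solution_def)
  show "ode_solution n a \<sigma> U"
    unfolding U using \<omega>_ode by (intro ode_solution_sum n w) auto
  fix k
  have "bdry_form n \<alpha> \<beta> k U = bdry_form n \<alpha> \<beta> k w + (\<Sum>i\<in>UNIV. \<delta> i * d $ i * bdry_form n \<alpha> \<beta> k (\<omega> i))"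
    unfolding U using bdry_form_lincomb wC \<omega>C
    by (intro linear_on_Ck_space_sum[where m="n - 1"]) auto
  also have "\<dots> = \<delta> k * d $ k"
    by (simp add: w \<omega>_bdry if_distrib cong: if_cong)
  finally have BU: "bdry_form n \<alpha> \<beta> k U = \<delta> k * d $ k" .
  have CU: "C k U = C k w + (\<Sum>i\<in>UNIV. \<delta> i * d $ i * C k (\<omega> i))"
    unfolding U using continuous_linear_functional_lincomb[OF C] wC \<omega>C
    by (intro linear_on_Ck_space_sum[where m="n - 1"]) auto
  have "(mat 1 - coupling_matrix C \<delta> \<omega>) *v d = (\<chi> j. C j w)"
    using det unfolding d_def b
    by (simp add: matrix_vector_mul_assoc matrix_mult_matrix_inv invertible_det_nz)
  then have "d - coupling_matrix C \<delta> \<omega> *v d = (\<chi> j. C j w)"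
    by (simp add: matrix_vector_mult_diff_rdistrib)
  then have "(d - coupling_matrix C \<delta> \<omega> *v d) $ k = C k w" by simp
  then have "d $ k = C k U"
    by (simp add: CU coupling_matrix_def matrix_vector_mult_def mult_ac)
  then show "bdry_form n \<alpha> \<beta> k U = \<delta> k * C k U" using BU by simp
qed

section \<open>Measurability and integrability of composed functions\<close>

text \<open>The values of \<open>u\<close> are rounded down to multiples of \<open>1/(m+1)\<close>: each rounded function is
  countably valued, so that only countably many of the functions \<open>f(\<cdot>,x)\<close> enter, and continuity
  in the second variable lets \<open>m\<close> tend to infinity.\<close>

lemma borel_measurable_superposition:
  fixes f :: "'a \<Rightarrow> real \<Rightarrow> real"
  assumes f: "\<And>x. (\<lambda>t. f t x) \<in> borel_measurable M"
    and cont: "\<And>t. t \<in> space M \<Longrightarrow> continuous_on UNIV (f t)"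
    and u: "u \<in> borel_measurable M"
  shows "(\<lambda>t. f t (u t)) \<in> borel_measurable M"
proof -
  define q where "q m t = real_of_int \<lfloor>real (Suc m) * u t\<rfloor> / real (Suc m)" for m t
  have meas: "(\<lambda>t. f t (q m t)) \<in> borel_measurable M" for m
    unfolding q_def
  proof (rule measurable_compose_countable[where
        f="\<lambda>i t. f t (real_of_int i / real (Suc m))" and g="\<lambda>t. \<lfloor>real (Suc m) * u t\<rfloor>"])
    show "(\<lambda>t. f t (real_of_int i / real (Suc m))) \<in> borel_measurable M" for i
      by (rule f)
    show "(\<lambda>t. \<lfloor>real (Suc m) * u t\<rfloor>) \<in> measurable M (count_space UNIV)"
      using u by measurable
  qed
  have lim: "(\<lambda>m. f t (q m t)) \<longlonglongrightarrow> f t (u t)" if "t \<in> space M" for t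
  proof -
    have "isCont (f t) (u t)"
      using cont that by (simp add: continuous_on_eq_continuous_at)
    moreover have "(\<lambda>m. q m t) \<longlonglongrightarrow> u t"
    proof (intro LIM_zero_cancel[of "\<lambda>m. q m t"] LIMSEQ_norm_0)
      fix m
      have "\<bar>real_of_int \<lfloor>real (Suc m) * u t\<rfloor> - real (Suc m) * u t\<bar> < 1"
        by linarith
      moreover have "q m t - u t =
          (real_of_int \<lfloor>real (Suc m) * u t\<rfloor> - real (Suc m) * u t) / real (Suc m)"
        by (simp add: q_def diff_divide_distrib)
      ultimately have "\<bar>q m t - u t\<bar> < 1 / real (Suc m)"
        by (simp add: abs_divide divide_strict_right_mono)
      then show "norm (q m t - u t) < 1 / real (Suc m)" by simp
    qed
    ultimately show ?thesis
      by (rule isCont_tendsto_compose)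
  qed
  show ?thesis
    by (rule borel_measurable_LIMSEQ_metric[OF meas lim])
qed

lemma integrable_lipschitz_superposition:
  fixes f :: "'a \<Rightarrow> real \<Rightarrow> real"
  assumes f: "\<And>x. (\<lambda>t. f t x) \<in> borel_measurable M" and f0: "integrable M (\<lambda>t. f t 0)"
    and K: "integrable M K" "\<And>t. t \<in> space M \<Longrightarrow> 0 \<le> K t"
    and lip: "\<And>t x y. t \<in> space M \<Longrightarrow> \<bar>f t x - f t y\<bar> \<le> K t * \<bar>x - y\<bar>"
    and u: "u \<in> borel_measurable M" "bounded (u ` space M)"
  shows "integrable M (\<lambda>t. f t (u t))"
proof -
  obtain R where R: "\<And>t. t \<in> space M \<Longrightarrow> \<bar>u t\<bar> \<le> R"
    using u(2) by (auto simp: bounded_iff)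
  have "(K t)-lipschitz_on UNIV (f t)" if "t \<in> space M" for t
    using lip[OF that] K(2)[OF that] by (intro lipschitz_onI) (auto simp: dist_real_def)
  then have "continuous_on UNIV (f t)" if "t \<in> space M" for t
    using that lipschitz_on_continuous_on by blast
  then have meas: "(\<lambda>t. f t (u t)) \<in> borel_measurable M"
    by (rule borel_measurable_superposition[OF f _ u(1)])
  show ?thesis
  proof (rule Bochner_Integration.integrable_bound[OF _ meas])
    show "integrable M (\<lambda>t. \<bar>f t 0\<bar> + K t * R)"
      using f0 K(1) by simp
    have "\<bar>f t (u t)\<bar> \<le> \<bar>f t 0\<bar> + K t * R" if "t \<in> space M" for t
    proof -
      have "K t * \<bar>u t\<bar> \<le> K t * R"
        using R K(2) that by (intro mult_left_mono)
      then show ?thesis using lip[OF that, of "u t" 0] by simp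
    qed
    then show "AE t in M. norm (f t (u t)) \<le> norm (\<bar>f t 0\<bar> + K t * R)"
      by (intro AE_I2) (simp add: order_trans[OF _ abs_ge_self])
  qed
qed

lemma caratheodory_integrable_at:
  assumes "caratheodory n f"
  shows "integrable (lebesgue_on {0..1}) (\<lambda>t. f t x)"
proof -
  let ?M = "lebesgue_on {0..1::real}"
  interpret finite_measure ?M by (rule finite_measure_lebesgue_on) simp
  have meas: "(\<lambda>t. f t x) \<in> borel_measurable ?M"
    using assms by (simp add: caratheodory_def)
  have "\<bar>x\<bar> + 1 > 0" by simp
  then obtain \<phi> where
    \<phi>: "if n = 1 then \<phi> \<in> borel_measurable ?M \<and> (\<exists>B. AE t in ?M. \<bar>\<phi> t\<bar> \<le> B) else integrable ?M \<phi>"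
    and bnd: "AE t in ?M. \<forall>y\<in>{-(\<bar>x\<bar> + 1)..\<bar>x\<bar> + 1}. \<bar>f t y\<bar> \<le> \<phi> t"
    using assms unfolding caratheodory_def by blast
  have "integrable ?M \<phi>"
  proof (cases "n = 1")
    case True
    then obtain B where "\<phi> \<in> borel_measurable ?M" "AE t in ?M. \<bar>\<phi> t\<bar> \<le> B"
      using \<phi> by auto
    then show ?thesis by (intro integrable_const_bound[of \<phi> B]) simp_all
  qed (use \<phi> in simp)
  then show ?thesis
  proof (rule Bochner_Integration.integrable_bound[OF _ meas])
    show "AE t in ?M. norm (f t x) \<le> norm (\<phi> t)"
      using bnd
    proof eventually_elim
      case (elim t)
      then have "\<bar>f t x\<bar> \<le> \<phi> t" by (rule bspec) auto
      then show ?case by simp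
    qed
  qed
qed

section \<open>The contraction\<close>

text \<open>A continuous function on \<open>{0..1}\<close> is extended to a bounded continuous function on the line
  that is constant on either side of the interval, which places it in the complete space of bounded continuous functions.\<close>

lemma contraction_fixed_point_on_unit_interval:
  fixes T :: "(real \<Rightarrow> real) \<Rightarrow> real \<Rightarrow> real"
  assumes q: "0 \<le> q" "q < 1"
    and T: "\<And>u. continuous_on {0..1} u \<Longrightarrow> continuous_on {0..1} (T u)"
    and contr: "\<And>u v d t. continuous_on {0..1} u \<Longrightarrow> continuous_on {0..1} v \<Longrightarrow>
        (\<And>s. s \<in> {0..1} \<Longrightarrow> \<bar>u s - v s\<bar> \<le> d) \<Longrightarrow> t \<in> {0..1} \<Longrightarrow> \<bar>T u t - T v t\<bar> \<le> q * d"
  obtains u where "continuous_on {0..1} u" "\<And>t. t \<in> {0..1} \<Longrightarrow> T u t = u t"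
proof -
  define S where "S F = Bcontfun (\<lambda>x. T (apply_bcontfun F) (clamp 0 1 x))" for F :: "real \<Rightarrow>\<^sub>C real"
  have cont: "continuous_on {0..1} (apply_bcontfun F)" for F :: "real \<Rightarrow>\<^sub>C real"
    by simp
  have S: "apply_bcontfun (S F) x = T (apply_bcontfun F) (clamp 0 1 x)" for F x
  proof -
    have c: "continuous_on (cbox 0 1) (T (apply_bcontfun F))"
      using T[OF cont] by simp
    then have "bounded (T (apply_bcontfun F) ` cbox 0 1)"
      by (intro compact_imp_bounded compact_continuous_image) auto
    then have "(\<lambda>x. T (apply_bcontfun F) (clamp 0 1 x)) \<in> bcontfun"
      using c unfolding bcontfun_def by (auto intro: clamp_continuous_on clamp_bounded)
    then show ?thesis by (simp add: S_def Bcontfun_inverse)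
  qed
  have "dist (S F) (S H) \<le> q * dist F H" for F H
  proof (rule dist_bound)
    fix x :: real
    have "clamp 0 1 x \<in> {0..1::real}"
      using clamp_in_interval[of 0 "1::real" x] by simp
    then show "dist (apply_bcontfun (S F) x) (apply_bcontfun (S H) x) \<le> q * dist F H"
      unfolding S dist_real_def
      using dist_bounded[of F _ H] by (intro contr cont) (simp_all add: dist_real_def)
  qed
  then obtain F where F: "S F = F"
    using banach_fix_type[of q S] q by blast
  have "T (apply_bcontfun F) t = apply_bcontfun F t" if "t \<in> {0..1}" for t
    using S[of F t] that by (simp add: F)
  then show ?thesis using that cont by blast
qed

theorem theorem5p4:
  fixes n :: nat
    and a :: "nat \<Rightarrow> real \<Rightarrow> real"
    and \<alpha> \<beta> :: "'n::finite \<Rightarrow> nat \<Rightarrow> real"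
    and C :: "'n \<Rightarrow> (real \<Rightarrow> real) \<Rightarrow> real"
    and \<delta> :: "'n \<Rightarrow> real"
    and g :: "real \<Rightarrow> real \<Rightarrow> real"
    and \<omega> :: "'n \<Rightarrow> real \<Rightarrow> real"
    and b :: "real^'n^'n"
    and Cg :: "'n \<Rightarrow> real \<Rightarrow> real"
    and f :: "real \<Rightarrow> real \<Rightarrow> real"
    and K :: "real \<Rightarrow> real"
    and P :: real
  assumes "n = CARD('n)"
    and "\<And>i. i \<in> {1..n} \<Longrightarrow> integrable (lebesgue_on {0..1}) (a i)"
    and "\<And>i. continuous_linear_functional (n - 1) (C i)"
    and "\<And>u. ode_solution n a (\<lambda>t. 0) u \<Longrightarrow> (\<And>i. bdry_form n \<alpha> \<beta> i u = 0) \<Longrightarrow>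
             (\<And>t. t \<in> {0..1} \<Longrightarrow> u t = 0)"
    and "greens_function n a \<alpha> \<beta> g"
    and "\<And>i. unique_bvp_solution n a \<alpha> \<beta> (\<lambda>t. 0) (\<lambda>k. if k = i then 1 else 0) (\<omega> i)"
    and "det (mat 1 - coupling_matrix C \<delta> \<omega>) \<noteq> 0"
    and "b = matrix_inv (mat 1 - coupling_matrix C \<delta> \<omega>)"
    and "\<And>j. functional_of_kernel (C j) g (Cg j)"
    and "caratheodory n f"
    and "integrable (lebesgue_on {0..1}) K"
    and "\<And>t. t \<in> {0..1} \<Longrightarrow> 0 \<le> K t"
    and "\<And>t x y. t \<in> {0..1} \<Longrightarrow> \<bar>f t x - f t y\<bar> \<le> K t * \<bar>x - y\<bar>"
    and P_attained: "\<exists>t\<in>{0..1}. P = (LINT s|lebesgue_on {0..1}. \<bar>nonlocal_green g \<delta> b \<omega> Cg t s\<bar> * K s)"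
    and P_upper: "\<And>t. t \<in> {0..1} \<Longrightarrow>
             (LINT s|lebesgue_on {0..1}. \<bar>nonlocal_green g \<delta> b \<omega> Cg t s\<bar> * K s) \<le> P"
    and "P < 1"
  shows "\<exists>u. continuous_on {0..1} u \<and> ode_solution n a (\<lambda>t. f t (u t)) u \<and>
             (\<forall>i. bdry_form n \<alpha> \<beta> i u = \<delta> i * C i u)"
proof -
  let ?M = "lebesgue_on {0..1::real}"
  let ?G = "nonlocal_green g \<delta> b \<omega> Cg"
  have n: "n \<ge> 1" using assms(1) by (simp add: Suc_leI)
  have space: "space ?M = {0..1}" by (simp add: space_restrict_space)
  define F where "F u = (\<lambda>s. f s (u s))" for u :: "real \<Rightarrow> real"
  have FI: "integrable ?M (F u)" if u: "continuous_on {0..1} u" for u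
    unfolding F_def
  proof (rule integrable_lipschitz_superposition[where f=f and K=K])
    show "(\<lambda>t. f t x) \<in> borel_measurable ?M" for x
      using assms(10) by (simp add: caratheodory_def)
    show "integrable ?M (\<lambda>t. f t 0)"
      by (rule caratheodory_integrable_at[OF assms(10)])
    show "u \<in> borel_measurable ?M"
      using u by (rule continuous_imp_measurable_on_sets_lebesgue) simp
    show "bounded (u ` space ?M)"
      unfolding space using u by (intro compact_imp_bounded compact_continuous_image) auto
  qed (use assms(11-13) space in auto)
  define w where "w u = (\<lambda>t. LINT s|?M. g t s * F u s)" for u
  define U where "U u = (\<lambda>t. w u t + (\<Sum>i\<in>UNIV. \<delta> i * (b *v (\<chi> j. C j (w u))) $ i * \<omega> i t))" for u
  have GI: "integrable ?M (\<lambda>s. ?G t s * \<sigma> s)" if "integrable ?M \<sigma>" "t \<in> {0..1}" for t \<sigma>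
    using nonlocal_green_integral(1)[where C=C and Cg=Cg, OF assms(5,9) that] .
  have U_eq: "U u t = (LINT s|?M. ?G t s * F u s)" if "continuous_on {0..1} u" "t \<in> {0..1}" for u t
    unfolding U_def w_def
    using nonlocal_green_integral(2)[where C=C and Cg=Cg, OF assms(5,9) FI[OF that(1)] that(2)] by simp
  have U_sol: "ode_solution n a (F u) (U u)" "bdry_form n \<alpha> \<beta> k (U u) = \<delta> k * C k (U u)"
    if "continuous_on {0..1} u" for u k
  proof -
    have w: "ode_solution n a (F u) (w u)" "bdry_form n \<alpha> \<beta> i (w u) = 0" for i
      using assms(5) FI[OF that] by (auto simp: greens_function_def unique_bvp_solution_def w_def)
    show "ode_solution n a (F u) (U u)" "bdry_form n \<alpha> \<beta> k (U u) = \<delta> k * C k (U u)"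
      unfolding U_def by (rule nonlocal_problem_solution[OF n assms(3,6,7,8) w])+
  qed
  have U_cont: "continuous_on {0..1} (U u)" if "continuous_on {0..1} u" for u
    using U_sol(1)[OF that] Ck_space_imp_continuous by (auto simp: ode_solution_def)
  have U_contr: "\<bar>U u t - U v t\<bar> \<le> P * d"
    if u: "continuous_on {0..1} u" and v: "continuous_on {0..1} v"
      and d: "\<And>s. s \<in> {0..1} \<Longrightarrow> \<bar>u s - v s\<bar> \<le> d" and t: "t \<in> {0..1}" for u v d t
  proof -
    have d0: "0 \<le> d" using d[of 0] by simp
    have "integrable ?M (\<lambda>s. \<bar>?G t s * K s\<bar>)"
      using GI[OF assms(11) t] by (rule integrable_abs)
    then have GK: "integrable ?M (\<lambda>s. \<bar>?G t s\<bar> * K s)"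
      by (rule Bochner_Integration.integrable_cong[THEN iffD1, rotated -1])
        (use assms(12) space in \<open>auto simp: abs_mult\<close>)
    have "\<bar>U u t - U v t\<bar> = \<bar>LINT s|?M. ?G t s * F u s - ?G t s * F v s\<bar>"
      using u v t GI FI by (simp add: U_eq)
    also have "\<dots> \<le> (LINT s|?M. \<bar>?G t s * F u s - ?G t s * F v s\<bar>)"
      by (rule integral_abs_bound)
    also have "\<dots> \<le> (LINT s|?M. (\<bar>?G t s\<bar> * K s) * d)"
    proof (rule integral_mono)
      show "integrable ?M (\<lambda>s. \<bar>?G t s * F u s - ?G t s * F v s\<bar>)"
        using u v t GI FI by (intro integrable_abs Bochner_Integration.integrable_diff) auto
      show "integrable ?M (\<lambda>s. (\<bar>?G t s\<bar> * K s) * d)"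
        using GK by simp
      fix s assume "s \<in> space ?M"
      then have s: "s \<in> {0..1}" by (simp add: space)
      have "\<bar>F u s - F v s\<bar> \<le> K s * \<bar>u s - v s\<bar>"
        unfolding F_def by (rule assms(13)[OF s])
      also have "\<dots> \<le> K s * d"
        using assms(12) d s by (intro mult_left_mono) auto
      finally have "\<bar>?G t s\<bar> * \<bar>F u s - F v s\<bar> \<le> \<bar>?G t s\<bar> * (K s * d)"
        by (rule mult_left_mono) simp
      then show "\<bar>?G t s * F u s - ?G t s * F v s\<bar> \<le> (\<bar>?G t s\<bar> * K s) * d"
        by (simp add: abs_mult mult.assoc flip: right_diff_distrib)
    qed
    also have "\<dots> \<le> P * d"
      using P_upper[OF t] d0 by (simp add: mult_right_mono)
    finally show ?thesis .
  qed
  \<comment> \<open>As the value of an integral of a nonnegative function, \<open>P\<close> is an admissible contraction factor.\<close>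
  have "0 \<le> P"
  proof -
    obtain t where "P = (LINT s|?M. \<bar>?G t s\<bar> * K s)"
      using P_attained by blast
    then show ?thesis
      using assms(12) space by (auto intro!: Bochner_Integration.integral_nonneg)
  qed
  then obtain u where u: "continuous_on {0..1} u" "\<And>t. t \<in> {0..1} \<Longrightarrow> U u t = u t"
    using contraction_fixed_point_on_unit_interval[of P U] \<open>P < 1\<close> U_cont U_contr by metis
  \<comment> \<open>The witness is \<open>U u\<close> rather than \<open>u\<close>: the boundary conditions are known for it as a function
    on the line, while \<open>u\<close> agrees with it on \<open>{0..1}\<close> only.\<close>
  have "ode_solution n a (\<lambda>t. f t (U u t)) (U u)"
    using ode_solution_cong[OF U_sol(1)[OF u(1)]] u(2) by (simp add: F_def)
  then show ?thesis
    using U_cont[OF u(1)] U_sol(2)[OF u(1)] by blast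
qed

end
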